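(* Let $\Omega_0:=\mathbb{R}\times(0,1)$. Suppose that $v=(v_1,v_2)\in C^2(\overline{\Omega_0})$ satisfies (together with a scalar pressure $p$) the steady hydrostatic Euler equations $$v_1\partial_{x_1}v_1+v_2\partial_{x_2}v_1=-\partial_{x_1}p,\qquad 0=-\partial_{x_2}p,\qquad \partial_{x_1}v_1+\partial_{x_2}v_2=0\qquad\text{in }\Omega_0,$$ with the slip boundary condition $v\cdot\nu=0$ on $\partial\Omega_0$. If $\epsilon_0:=\inf_{x\in\Omega_0}|v(x)|>0$, then $v$ is a steady shear flow, namely $v_2\equiv 0$ and $v_1$ depends only on $x_2$: $$v(x)=(v_1(x_2),0)\quad\text{in }\overline{\Omega_0}.$$
   Context: Here $x=(x_1,x_2)$, $\nu$ is the unit outward normal to $\partial\Omega_0$ (so the boundary condition reads $v_2=0$ on $x_2=0$ and on $x_2=1$), and $|v|=\sqrt{v_1^2+v_2^2}$. *)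

theory Defs
  imports "HOL-Analysis.Analysis"
begin

definition strip :: "(real \<times> real) set"
  where "strip = UNIV \<times> {0<..<1}"

definition partial_deriv ::
    "'a \<Rightarrow> ('a::euclidean_space \<Rightarrow> 'b::real_normed_vector) \<Rightarrow> 'a \<Rightarrow> 'b"
  where "partial_deriv b f x = vector_derivative (\<lambda>t. f (x + t *\<^sub>R b)) (at 0)"

text \<open>
  The space of functions that are k times continuously differentiable up to the boundary of
  an open set \<open>\<Omega>\<close>: all partial derivatives of order at most k exist in \<open>\<Omega>\<close> and
  extend continuously to the closure of \<open>\<Omega>\<close>. Below, \<open>g b\<close> is such an extension of the
  derivative in direction \<open>b\<close>. No boundedness is required, and values of f outside
  the closure are irrelevant.
\<close>
primrec Ck_closure ::
    "nat \<Rightarrow> 'a::euclidean_space set \<Rightarrow> ('a \<Rightarrow> 'b::real_normed_vector) \<Rightarrow> bool"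
  where
    "Ck_closure 0 \<Omega> f \<longleftrightarrow> continuous_on (closure \<Omega>) f"
  | "Ck_closure (Suc k) \<Omega> f \<longleftrightarrow>
       continuous_on (closure \<Omega>) f \<and>
       (\<exists>g. \<forall>b\<in>Basis. Ck_closure k \<Omega> (g b) \<and>
            (\<forall>x\<in>\<Omega>. ((\<lambda>t. f (x + t *\<^sub>R b)) has_vector_derivative g b x) (at 0)))"

abbreviation D1 :: "(real \<times> real \<Rightarrow> real) \<Rightarrow> real \<times> real \<Rightarrow> real"
  where "D1 \<equiv> partial_deriv (1, 0)"

abbreviation D2 :: "(real \<times> real \<Rightarrow> real) \<Rightarrow> real \<times> real \<Rightarrow> real"
  where "D2 \<equiv> partial_deriv (0, 1)"

definition steady_hydrostatic_euler ::
    "(real \<times> real) set \<Rightarrow> (real \<times> real \<Rightarrow> real \<times> real) \<Rightarrow> (real \<times> real \<Rightarrow> real) \<Rightarrow> bool"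
  where
    "steady_hydrostatic_euler \<Omega> v p \<longleftrightarrow>
       (let v1 = (\<lambda>x. fst (v x)); v2 = (\<lambda>x. snd (v x)) in
        \<forall>x\<in>\<Omega>. v1 x * D1 v1 x + v2 x * D2 v1 x = - D1 p x \<and>
               0 = - D2 p x \<and>
               D1 v1 x + D2 v2 x = 0)"

text \<open>The unit outward normal of the strip; only meaningful on its frontier, where the
  second coordinate is 0 or 1.\<close>
definition strip_normal :: "real \<times> real \<Rightarrow> real \<times> real"
  where "strip_normal x = (0, if snd x = 0 then - 1 else 1)"

end

theory Submission
  imports Defs
begin

text \<open>
  Write \<open>v = (u, w)\<close>. The pressure depends on the first coordinate only, \<open>p(x, y) = P(x)\<close>; let
  \<open>q = P'\<close>. Incompressibility turns the momentum equation into
  \<open>u w\<^sub>y - w u\<^sub>y = q(x)\<close>, whose left-hand side is \<open>\<bar>v\<bar>\<^sup>2 \<theta>\<^sub>y\<close> for an angle \<open>\<theta>\<close> of the vector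
  \<open>v\<close>. So on the vertical segment over \<open>x\<close> the velocity turns in one direction, with angular speed
  \<open>q(x) / \<bar>v\<bar>\<^sup>2\<close>, and the slip condition forces it to be horizontal at both ends. The total turning
  is therefore a multiple of \<open>\<pi>\<close>: either there is none, and then \<open>q(x) = 0\<close> and \<open>w = 0\<close> on the whole
  segment, or it is at least \<open>\<pi>\<close>, and then \<open>\<bar>q(x)\<bar> \<ge> \<pi> \<epsilon>\<^sup>2\<close>, where \<open>\<epsilon>\<close> is the positive lower bound of
  the speed (\<open>constant_wronskian_dichotomy\<close>).

  Since \<open>q\<close> is continuous, the same alternative and the same sign hold for all \<open>x\<close>
  (\<open>continuous_gap_at_zero\<close>). In the second alternative \<open>P\<close> would tend to \<open>+\<infinity>\<close> at one end of the
  strip. But Bernoulli's law along the bottom wall, where \<open>w = 0\<close>, says that \<open>u\<^sup>2/2 + P\<close> is constant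
  there (\<open>constant_along_bottom\<close>), so \<open>P\<close> is bounded above. Hence \<open>q\<close> and \<open>w\<close> vanish identically, and
  incompressibility gives \<open>u\<^sub>x = - w\<^sub>y = 0\<close>.
\<close>

section \<open>Turning of a plane curve with constant Wronskian\<close>

text \<open>
  The curve \<open>(a, b)\<close> has angular velocity \<open>q / (a\<^sup>2 + b\<^sup>2)\<close>, starts on the horizontal axis and
  returns to it, so its total turning is in \<open>\<pi>\<int>\<close>. Instead of lifting the angle of the curve, the
  proof integrates this angular velocity to a function \<open>\<theta>\<close> and checks that the curve, rotated back
  by \<open>\<theta>\<close>, never leaves the horizontal axis.
\<close>
lemma constant_wronskian_dichotomy:
  fixes a b a' b' :: "real \<Rightarrow> real"
  assumes cont: "continuous_on {0..1} a" "continuous_on {0..1} b"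
    and a': "\<And>y. y \<in> {0<..<1} \<Longrightarrow> (a has_real_derivative a' y) (at y)"
    and b': "\<And>y. y \<in> {0<..<1} \<Longrightarrow> (b has_real_derivative b' y) (at y)"
    and wronskian: "\<And>y. y \<in> {0<..<1} \<Longrightarrow> a y * b' y - b y * a' y = q"
    and away: "\<And>y. y \<in> {0..1} \<Longrightarrow> \<epsilon>\<^sup>2 \<le> (a y)\<^sup>2 + (b y)\<^sup>2" and "\<epsilon> > 0"
    and ends: "b 0 = 0" "b 1 = 0"
  shows "(q = 0 \<and> (\<forall>y\<in>{0..1}. b y = 0)) \<or> pi * \<epsilon>\<^sup>2 \<le> \<bar>q\<bar>"
proof -
  define N where "N y = (a y)\<^sup>2 + (b y)\<^sup>2" for y
  have \<epsilon>2: "\<epsilon>\<^sup>2 > 0" using \<open>\<epsilon> > 0\<close> by simp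
  have N: "\<epsilon>\<^sup>2 \<le> N y" "0 < N y" if "y \<in> {0..1}" for y
    using away[OF that] \<epsilon>2 unfolding N_def by linarith+
  have contN: "continuous_on {0..1} N"
    unfolding N_def by (intro continuous_intros cont)
  have contQ: "continuous_on {0..1} (\<lambda>y. q / N y)"
    using N by (intro continuous_intros contN) force
  define \<theta> where "\<theta> y = integral {0..y} (\<lambda>s. q / N s)" for y
  have d\<theta>: "(\<theta> has_real_derivative q / N y) (at y within {0..1})" if "y \<in> {0..1}" for y
    using integral_has_vector_derivative[OF contQ that]
    by (simp add: \<theta>_def[abs_def] has_real_derivative_iff_has_vector_derivative)
  have cont\<theta>: "continuous_on {0..1} \<theta>"
    by (rule DERIV_continuous_on) (rule d\<theta>)
  have d\<theta>': "(\<theta> has_real_derivative q / N y) (at y)" if "y \<in> {0<..<1}" for y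
  proof -
    have "at y within {0..1} = at y" using that by (intro at_within_interior) simp
    then show ?thesis using d\<theta>[of y] that by simp
  qed
  have \<theta>0: "\<theta> 0 = 0" by (simp add: \<theta>_def)
  \<comment> \<open>\<open>G\<close> is the vertical component of the curve after rotation by \<open>- \<theta>\<close>. The derivative of the
    rotated curve is a multiple of the rotated curve, so the squared sine \<open>G\<^sup>2 / N\<close> of its angle is
    constant.\<close>
  define G where "G y = b y * cos (\<theta> y) - a y * sin (\<theta> y)" for y
  have contG: "continuous_on {0..1} (\<lambda>y. (G y)\<^sup>2 / N y)"
    unfolding G_def using N
    by (intro continuous_intros cont contN cont\<theta>) force
  have dG: "((\<lambda>y. (G y)\<^sup>2 / N y) has_real_derivative 0) (at y)" if y: "y \<in> {0<..<1}" for y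
  proof -
    have Ny: "N y > 0" using N y by simp
    define r where "r = (a y * a' y + b y * b' y) / N y"
    have dN: "(N has_real_derivative 2 * r * N y) (at y)"
      unfolding N_def[abs_def] using Ny
      by (auto intro!: derivative_eq_intros a' b' y simp: r_def N_def)
    have qN: "a y * b' y - b y * a' y = q" by (rule wronskian[OF y])
    \<comment> \<open>Decompose the velocity into its radial part, with growth rate \<open>r\<close>, and its angular part.\<close>
    have a'y: "a' y = r * a y - q / N y * b y"
      unfolding r_def qN[symmetric] using Ny
      by (simp add: field_simps) (simp add: N_def power2_eq_square algebra_simps)
    have b'y: "b' y = r * b y + q / N y * a y"
      unfolding r_def qN[symmetric] using Ny
      by (simp add: field_simps) (simp add: N_def power2_eq_square algebra_simps)
    have "(G has_real_derivative (b' y * cos (\<theta> y) - b y * (sin (\<theta> y) * (q / N y))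
             - (a' y * sin (\<theta> y) + a y * (cos (\<theta> y) * (q / N y))))) (at y)"
      unfolding G_def[abs_def]
      by (auto intro!: derivative_eq_intros a' b' y d\<theta>' simp: algebra_simps)
    also have "(b' y * cos (\<theta> y) - b y * (sin (\<theta> y) * (q / N y))
             - (a' y * sin (\<theta> y) + a y * (cos (\<theta> y) * (q / N y)))) = r * G y"
      unfolding a'y b'y G_def by (simp add: algebra_simps)
    finally have dG: "(G has_real_derivative r * G y) (at y)" .
    show ?thesis
      using Ny by (auto intro!: derivative_eq_intros dG dN simp: power2_eq_square)
  qed
  have G0: "G y = 0" if y: "y \<in> {0..1}" for y
  proof -
    have "(G y)\<^sup>2 / N y = (G 0)\<^sup>2 / N 0"
      using DERIV_isconst2[OF _ contG, of y] dG y by auto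
    also have "\<dots> = 0" by (simp add: G_def \<theta>0 ends)
    finally show ?thesis using N(2)[OF y] by simp
  qed
  show ?thesis
  proof (cases "q = 0")
    case True
    then have "\<theta> y = 0" for y by (simp add: \<theta>_def)
    then show ?thesis using G0 True by (auto simp: G_def)
  next
    case False
    have "pi * \<epsilon>\<^sup>2 \<le> \<bar>q\<bar>"
    proof (rule ccontr)
      assume small: "\<not> ?thesis"
      have "\<theta> differentiable (at y)" if "0 < y" "y < 1" for y
        using d\<theta>'[of y] that by (auto simp: real_differentiable_def)
      then obtain l z where z: "0 < z" "z < 1" "(\<theta> has_real_derivative l) (at z)"
          "\<theta> 1 - \<theta> 0 = (1 - 0) * l"
        using MVT[OF zero_less_one cont\<theta>] by blast
      then have l: "l = q / N z"
        using d\<theta>'[of z] DERIV_unique by auto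
      have Nz: "0 < N z" "\<epsilon>\<^sup>2 \<le> N z" using N z by auto
      have "\<bar>q\<bar> < pi * N z"
        using small Nz mult_left_mono[OF Nz(2) pi_ge_zero] by linarith
      then have "\<bar>\<theta> 1\<bar> < pi"
        using z(4) l Nz \<theta>0 by (simp add: abs_divide pos_divide_less_eq)
      moreover have "\<theta> 1 \<noteq> 0" using z(4) l Nz \<theta>0 False by simp
      ultimately have "sin (\<theta> 1) \<noteq> 0"
        using sin_eq_0_pi by (metis abs_less_iff minus_less_iff)
      moreover have "a 1 \<noteq> 0" using N(2)[of 1] ends by (auto simp: N_def)
      ultimately show False using G0[of 1] ends by (simp add: G_def)
    qed
    then show ?thesis by blast
  qed
qed

section \<open>A continuous function with a gap in its values\<close>

lemma continuous_gap_at_zero: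
  fixes q :: "real \<Rightarrow> real"
  assumes cont: "continuous_on UNIV q" and "c > 0"
    and gap: "\<And>x. q x = 0 \<or> c \<le> \<bar>q x\<bar>"
  shows "(\<forall>x. q x = 0) \<or> (\<forall>x. c \<le> q x) \<or> (\<forall>x. q x \<le> - c)"
proof -
  have conn: "connected (range q)"
    using cont connected_continuous_image by blast
  have mid: False if "q x \<le> s" "s \<le> q z" "0 < \<bar>s\<bar>" "\<bar>s\<bar> < c" for x z s
  proof -
    have "s \<in> range q"
      using connected_contains_Icc[OF conn, of "q x" "q z"] that by auto
    then show False using gap that by force
  qed
  have "q x \<le> 0 \<or> c \<le> q z" for x z
    using mid[of z "c/2" x] gap[of x] gap[of z] \<open>c > 0\<close> by (auto simp: abs_if split: if_splits)
  moreover have "0 \<le> q x \<or> q z \<le> - c" for x z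
    using mid[of x "- c/2" z] gap[of x] gap[of z] \<open>c > 0\<close> by (auto simp: abs_if split: if_splits)
  ultimately show ?thesis by (metis order_antisym)
qed

section \<open>Functions on the strip\<close>

text \<open>
  The derivative of \<open>f\<close> along horizontal lines is only known inside the strip, and vanishes in the
  limit at the bottom. The mean value theorem on horizontal segments approaching the bottom passes
  this to the boundary values of \<open>f\<close>: the intermediate points vary with the height, but they stay in
  a compact set, on which \<open>F\<close> is uniformly continuous.
\<close>
lemma constant_along_bottom:
  fixes f F :: "real \<times> real \<Rightarrow> real"
  assumes f: "continuous_on (UNIV \<times> {0..1}) f" and F: "continuous_on (UNIV \<times> {0..1}) F"
    and deriv: "\<And>x y. y \<in> {0<..<1} \<Longrightarrow> ((\<lambda>s. f (s, y)) has_real_derivative F (x, y)) (at x)"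
    and F0: "\<And>x. F (x, 0) = 0"
  shows "f (x, 0) = f (z, 0)"
proof -
  have *: "f (x, 0) = f (z, 0)" if "x < z" for x z
  proof -
    define \<eta> :: "nat \<Rightarrow> real" where "\<eta> n = inverse (real (Suc (Suc n)))" for n
    have \<eta>: "\<eta> n \<in> {0<..<1}" for n by (simp add: \<eta>_def inverse_less_1_iff)
    have \<eta>0: "\<eta> \<longlonglongrightarrow> 0"
      unfolding \<eta>_def using LIMSEQ_Suc[OF LIMSEQ_inverse_real_of_nat] by simp
    have "\<exists>t. x < t \<and> t < z \<and> f (z, \<eta> n) - f (x, \<eta> n) = (z - x) * F (t, \<eta> n)" for n
      using MVT2[OF that, of "\<lambda>s. f (s, \<eta> n)" "\<lambda>s. F (s, \<eta> n)"] deriv[OF \<eta>] by blast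
    then obtain t where t: "\<And>n. x < t n" "\<And>n. t n < z"
      and mvt: "\<And>n. f (z, \<eta> n) - f (x, \<eta> n) = (z - x) * F (t n, \<eta> n)" by metis
    have "uniformly_continuous_on ({x..z} \<times> {0..1}) F"
      by (intro compact_uniformly_continuous compact_Times continuous_on_subset[OF F]) auto
    then have "(\<lambda>n. dist (F (t n, \<eta> n)) (F (t n, 0))) \<longlonglongrightarrow> 0"
      unfolding uniformly_continuous_on_sequentially
      using t \<eta> \<eta>0 by (auto simp: dist_Pair_Pair less_imp_le
          dest!: spec[of _ "\<lambda>n. (t n, \<eta> n)"] spec[of _ "\<lambda>n. (t n, 0)"])
    then have "(\<lambda>n. (z - x) * F (t n, \<eta> n)) \<longlonglongrightarrow> 0"
      by (intro tendsto_mult_right_zero) (simp add: F0 tendsto_rabs_zero_iff)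
    moreover have lim: "(\<lambda>n. f (s, \<eta> n)) \<longlonglongrightarrow> f (s, 0)" for s
      using \<eta> by (intro continuous_on_tendsto_compose[OF f] tendsto_intros \<eta>0)
        (auto simp: less_imp_le)
    ultimately have "f (z, 0) - f (x, 0) = 0"
      using tendsto_diff[OF lim[of z] lim[of x]] LIMSEQ_unique unfolding mvt by blast
    then show ?thesis by simp
  qed
  show ?thesis using *[of x z] *[of z x] by (metis linorder_less_linear)
qed

lemma closure_strip: "closure strip = UNIV \<times> {0..1}"
  by (simp add: strip_def closure_Times)

lemma frontier_strip: "frontier strip = UNIV \<times> {0, 1}"
  by (auto simp: frontier_def closure_strip) (auto simp: strip_def interior_Times)

lemma D1_eq: "D1 f (x, y) = d" if "((\<lambda>s. f (s, y)) has_real_derivative d) (at x)"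
  using that DERIV_shift[of "\<lambda>s. f (s, y)" d 0 x]
  by (auto simp: partial_deriv_def has_real_derivative_iff_has_vector_derivative add.commute
      intro!: vector_derivative_at)

lemma D2_eq: "D2 f (x, y) = d" if "((\<lambda>s. f (x, s)) has_real_derivative d) (at y)"
  using that DERIV_shift[of "\<lambda>s. f (x, s)" d 0 y]
  by (auto simp: partial_deriv_def has_real_derivative_iff_has_vector_derivative add.commute
      intro!: vector_derivative_at)

lemma differentiable_on_strip_partials:
  assumes "f differentiable_on strip" and z: "(x, y) \<in> strip"
  shows "((\<lambda>s. f (s, y)) has_real_derivative D1 f (x, y)) (at x)"
    and "((\<lambda>s. f (x, s)) has_real_derivative D2 f (x, y)) (at y)"
proof -
  have "open strip" by (simp add: strip_def open_Times)
  then have "f differentiable at (x, y)"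
    using assms by (metis at_within_open differentiable_on_def)
  then obtain f' where f': "(f has_derivative f') (at (x, y))"
    by (auto simp: differentiable_def)
  have "((\<lambda>s. f (s, y)) has_derivative (\<lambda>h. f' (h, 0))) (at x)"
    by (rule has_derivative_compose[where f = "\<lambda>s. (s, y)", OF _ f'])
      (auto intro!: derivative_eq_intros)
  moreover have "((\<lambda>s. f (x, s)) has_derivative (\<lambda>h. f' (0, h))) (at y)"
    by (rule has_derivative_compose[where f = "\<lambda>s. (x, s)", OF _ f'])
      (auto intro!: derivative_eq_intros)
  ultimately have "(\<lambda>s. f (s, y)) differentiable at x" "(\<lambda>s. f (x, s)) differentiable at y"
    by (auto simp: differentiable_def)
  then obtain d1 d2 where "((\<lambda>s. f (s, y)) has_real_derivative d1) (at x)"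
    "((\<lambda>s. f (x, s)) has_real_derivative d2) (at y)"
    by (auto simp: real_differentiable_def)
  then show "((\<lambda>s. f (s, y)) has_real_derivative D1 f (x, y)) (at x)"
    "((\<lambda>s. f (x, s)) has_real_derivative D2 f (x, y)) (at y)"
    using D1_eq D2_eq by metis+
qed

section \<open>Rigidity of the flow\<close>

theorem theorem1p1:
  fixes v :: "real \<times> real \<Rightarrow> real \<times> real" and p :: "real \<times> real \<Rightarrow> real"
  assumes v_C2: "Ck_closure 2 strip v"
    and p_diff: "p differentiable_on strip"
    and euler: "steady_hydrostatic_euler strip v p"
    and slip: "\<forall>x\<in>frontier strip. v x \<bullet> strip_normal x = 0"
    and no_stagnation: "(INF x\<in>strip. norm (v x)) > 0"
  shows "\<exists>U :: real \<Rightarrow> real. \<forall>x\<in>closure strip. v x = (U (snd x), 0)"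
proof -
  define u where "u x = fst (v x)" for x
  define w where "w x = snd (v x)" for x
  define \<epsilon> where "\<epsilon> = (INF x\<in>strip. norm (v x))"
  have \<epsilon>: "\<epsilon> > 0" using no_stagnation by (simp add: \<epsilon>_def)
  have inside: "(x, y) \<in> strip" if "y \<in> {0<..<1}" for x y :: real
    using that by (simp add: strip_def)

  obtain g where cont_g: "\<And>b. b \<in> Basis \<Longrightarrow> continuous_on (closure strip) (g b)"
    and g: "\<And>b x. b \<in> Basis \<Longrightarrow> x \<in> strip \<Longrightarrow>
              ((\<lambda>t. v (x + t *\<^sub>R b)) has_vector_derivative g b x) (at 0)"
    and cont_v: "continuous_on (closure strip) v"
  proof -
    obtain g where "\<forall>b\<in>Basis. Ck_closure (Suc 0) strip (g b) \<and>
        (\<forall>x\<in>strip. ((\<lambda>t. v (x + t *\<^sub>R b)) has_vector_derivative g b x) (at 0))"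
      and "continuous_on (closure strip) v"
      using v_C2 unfolding numeral_2_eq_2 Ck_closure.simps(2)[of "Suc 0"] by blast
    then show ?thesis using that[of g] by simp
  qed
  have basis: "(1, 0) \<in> (Basis :: (real \<times> real) set)" "(0, 1) \<in> (Basis :: (real \<times> real) set)"
    by (auto simp: Basis_prod_def)
  define u\<^sub>x where "u\<^sub>x x = fst (g (1, 0) x)" for x
  define u\<^sub>y where "u\<^sub>y x = fst (g (0, 1) x)" for x
  define w\<^sub>y where "w\<^sub>y x = snd (g (0, 1) x)" for x
  have cont: "continuous_on (UNIV \<times> {0..1}) u" "continuous_on (UNIV \<times> {0..1}) w"
    "continuous_on (UNIV \<times> {0..1}) u\<^sub>x" "continuous_on (UNIV \<times> {0..1}) u\<^sub>y"
    using cont_v cont_g basis unfolding u_def w_def u\<^sub>x_def u\<^sub>y_def closure_strip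
    by (auto intro!: continuous_intros)

  have du_x: "((\<lambda>s. u (s, y)) has_real_derivative u\<^sub>x (x, y)) (at x)"
    and du_y: "((\<lambda>s. u (x, s)) has_real_derivative u\<^sub>y (x, y)) (at y)"
    and dw_y: "((\<lambda>s. w (x, s)) has_real_derivative w\<^sub>y (x, y)) (at y)"
    if "y \<in> {0<..<1}" for x y
  proof -
    have v_x: "((\<lambda>t. v (x + t, y)) has_vector_derivative g (1, 0) (x, y)) (at 0)"
      and v_y: "((\<lambda>t. v (x, y + t)) has_vector_derivative g (0, 1) (x, y)) (at 0)"
      using g[OF basis(1) inside[OF that]] g[OF basis(2) inside[OF that]] by simp_all
    show "((\<lambda>s. u (s, y)) has_real_derivative u\<^sub>x (x, y)) (at x)"
      using bounded_linear.has_vector_derivative[OF bounded_linear_fst v_x]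
        DERIV_shift[of "\<lambda>s. u (s, y)" "u\<^sub>x (x, y)" 0 x]
      by (simp add: u_def u\<^sub>x_def has_real_derivative_iff_has_vector_derivative add.commute)
    show "((\<lambda>s. u (x, s)) has_real_derivative u\<^sub>y (x, y)) (at y)"
      using bounded_linear.has_vector_derivative[OF bounded_linear_fst v_y]
        DERIV_shift[of "\<lambda>s. u (x, s)" "u\<^sub>y (x, y)" 0 y]
      by (simp add: u_def u\<^sub>y_def has_real_derivative_iff_has_vector_derivative add.commute)
    show "((\<lambda>s. w (x, s)) has_real_derivative w\<^sub>y (x, y)) (at y)"
      using bounded_linear.has_vector_derivative[OF bounded_linear_snd v_y]
        DERIV_shift[of "\<lambda>s. w (x, s)" "w\<^sub>y (x, y)" 0 y]
      by (simp add: w_def w\<^sub>y_def has_real_derivative_iff_has_vector_derivative add.commute)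
  qed

  have dp: "((\<lambda>s. p (s, y)) has_real_derivative D1 p (x, y)) (at x)"
           "((\<lambda>s. p (x, s)) has_real_derivative D2 p (x, y)) (at y)"
    if "y \<in> {0<..<1}" for x y
    using differentiable_on_strip_partials[OF p_diff inside[OF that]] by auto
  have "D1 (\<lambda>x. fst (v x)) (x, y) = u\<^sub>x (x, y) \<and> D2 (\<lambda>x. fst (v x)) (x, y) = u\<^sub>y (x, y) \<and>
        D2 (\<lambda>x. snd (v x)) (x, y) = w\<^sub>y (x, y)" if "y \<in> {0<..<1}" for x y
    using du_x[OF that] du_y[OF that] dw_y[OF that]
    by (auto simp: u_def w_def D1_eq D2_eq)
  with euler inside
  have momentum: "u (x, y) * u\<^sub>x (x, y) + w (x, y) * u\<^sub>y (x, y) = - D1 p (x, y)"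
    and hydrostatic: "D2 p (x, y) = 0"
    and incompressible: "u\<^sub>x (x, y) + w\<^sub>y (x, y) = 0" if "y \<in> {0<..<1}" for x y
    using that by (force simp: steady_hydrostatic_euler_def Let_def u_def w_def)+

  define P where "P x = p (x, 1/2)" for x
  define q where "q x = D1 p (x, 1/2)" for x
  have p_P: "p (x, y) = P x" if "y \<in> {0<..<1}" for x y
  proof -
    have "(\<lambda>s. p (x, s)) constant_on {0<..<1}"
      by (rule has_field_derivative_0_imp_constant_on) (use dp(2) hydrostatic in force)+
    then show ?thesis using that by (force simp: constant_on_def P_def)
  qed
  have dP: "(P has_real_derivative q x) (at x)" for x
    unfolding P_def q_def by (rule dp(1)) simp
  have D1p: "D1 p (x, y) = q x" if "y \<in> {0<..<1}" for x y
    using dp(1)[OF that, of x] dP[of x] DERIV_unique by (simp add: p_P[OF that])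

  have w_wall: "w (x, 0) = 0" "w (x, 1) = 0" for x
    using slip unfolding frontier_strip by (force simp: strip_normal_def w_def inner_prod_def)+

  have speed: "\<epsilon>\<^sup>2 \<le> (u (x, y))\<^sup>2 + (w (x, y))\<^sup>2" if "y \<in> {0..1}" for x y
  proof -
    have "strip \<noteq> {}" "bdd_below ((\<lambda>x. norm (v x)) ` strip)"
      using inside[of "1/2"] by (auto intro!: bdd_belowI[of _ 0])
    then have "\<epsilon> \<le> norm (v z)" if "z \<in> strip" for z
      unfolding \<epsilon>_def using that by (intro cINF_lower)
    then have "\<epsilon> \<le> norm (v (x, y))"
      using continuous_ge_on_closure[of strip "\<lambda>z. norm (v z)" "(x, y)" \<epsilon>] cont_v that
      by (auto simp: closure_strip intro: continuous_on_norm)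
    then show ?thesis
      using \<epsilon> by (cases "v (x, y)") (simp add: u_def w_def norm_prod_def real_le_rsqrt real_le_lsqrt sqrt_ge_absD)
  qed

  \<comment> \<open>On each vertical segment the velocity either stays horizontal or makes at least half a turn.\<close>
  have crossing: "(q x = 0 \<and> (\<forall>y\<in>{0..1}. w (x, y) = 0)) \<or> pi * \<epsilon>\<^sup>2 \<le> \<bar>q x\<bar>" for x
  proof (rule constant_wronskian_dichotomy)
    show "continuous_on {0..1} (\<lambda>y. u (x, y))" "continuous_on {0..1} (\<lambda>y. w (x, y))"
      by (auto intro!: continuous_on_compose2[OF cont(1)] continuous_on_compose2[OF cont(2)] continuous_intros)
    show "u (x, y) * w\<^sub>y (x, y) - w (x, y) * u\<^sub>y (x, y) = q x" if "y \<in> {0<..<1}" for y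
    proof -
      have "w\<^sub>y (x, y) = - u\<^sub>x (x, y)" using incompressible[OF that, of x] by simp
      then show ?thesis using momentum[OF that, of x] D1p[OF that, of x] by simp
    qed
  qed (use du_y dw_y speed \<epsilon> w_wall in auto)

  have cont_q: "continuous_on UNIV q"
  proof -
    \<comment> \<open>The momentum equation at mid-height expresses the pressure gradient, not itself assumed
      continuous, by continuous functions.\<close>
    have q: "q x = - (u (x, 1/2) * u\<^sub>x (x, 1/2) + w (x, 1/2) * u\<^sub>y (x, 1/2))" for x
      using momentum[of "1/2" x] by (simp add: q_def)
    show ?thesis
      unfolding q[abs_def] by (intro continuous_intros cont[THEN continuous_on_compose2]) auto
  qed

  have bernoulli: "(u (x, 0))\<^sup>2 / 2 + P x = (u (z, 0))\<^sup>2 / 2 + P z" for x z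
  proof -
    have contP: "continuous_on UNIV P"
      using dP by (intro DERIV_continuous_on) (auto intro: has_field_derivative_at_within)
    have "(u (x, 0))\<^sup>2 / 2 + P (fst (x, 0 :: real)) = (u (z, 0))\<^sup>2 / 2 + P (fst (z, 0 :: real))"
    proof (rule constant_along_bottom[where f = "\<lambda>x. (u x)\<^sup>2 / 2 + P (fst x)"
            and F = "\<lambda>x. - (w x * u\<^sub>y x)"])
      show "continuous_on (UNIV \<times> {0..1}) (\<lambda>x. (u x)\<^sup>2 / 2 + P (fst x))"
        by (intro continuous_intros cont continuous_on_compose2[OF contP]) auto
      show "continuous_on (UNIV \<times> {0..1}) (\<lambda>x. - (w x * u\<^sub>y x))"
        by (intro continuous_intros cont)
      show "((\<lambda>s. (u (s, y))\<^sup>2 / 2 + P (fst (s, y))) has_real_derivative - (w (x, y) * u\<^sub>y (x, y))) (at x)"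
        if "y \<in> {0<..<1}" for x y
        using momentum[OF that, of x] D1p[OF that, of x]
        by (auto intro!: derivative_eq_intros du_x[OF that] dP simp: mult.commute)
    qed (simp add: w_wall)
    then show ?thesis by simp
  qed

  have q0: "q x = 0" for x
  proof -
    define c where "c = pi * \<epsilon>\<^sup>2"
    have c: "c > 0" using \<epsilon> by (simp add: c_def)
    \<comment> \<open>Over the length \<open>L\<close> a pressure gradient of size \<open>c\<close> changes the pressure by more than the
      kinetic energy available at the origin.\<close>
    define L where "L = ((u (0, 0))\<^sup>2 / 2 + 1) / c"
    have L: "L > 0" "c * L = (u (0, 0))\<^sup>2 / 2 + 1" using c by (auto simp: L_def add_nonneg_pos)
    have bound: "P z - P 0 \<le> (u (0, 0))\<^sup>2 / 2" for z
      using bernoulli[of z 0] zero_le_power2[of "u (z, 0)"] by linarith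
    have "\<not> (\<forall>x. c \<le> q x)"
    proof
      assume *: "\<forall>x. c \<le> q x"
      obtain s where "P L - P 0 = (L - 0) * q s"
        using MVT2[OF L(1) dP] by blast
      then have "c * L \<le> P L - P 0"
        using * L(1) mult_left_mono[of c "q s" L] by (simp add: mult.commute)
      then show False using bound[of L] L(2) by linarith
    qed
    moreover have "\<not> (\<forall>x. q x \<le> - c)"
    proof
      assume *: "\<forall>x. q x \<le> - c"
      obtain s where "P 0 - P (- L) = (0 - (- L)) * q s"
        using MVT2[of "- L" 0 P q] L(1) dP by force
      then have "c * L \<le> P (- L) - P 0"
        using * L(1) mult_left_mono[of "q s" "- c" L] by (simp add: mult.commute)
      then show False using bound[of "- L"] L(2) by linarith
    qed
    ultimately show ?thesis
      using continuous_gap_at_zero[OF cont_q c] crossing unfolding c_def by blast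
  qed

  have w0: "w (x, y) = 0" if "y \<in> {0..1}" for x y
  proof -
    have "0 < pi * \<epsilon>\<^sup>2" using \<epsilon> by simp
    then show ?thesis using crossing[of x] q0[of x] that by auto
  qed
  have u_inner: "u (x, y) = u (0, y)" if y: "y \<in> {0<..<1}" for x y
  proof -
    have "w\<^sub>y (x, y) = 0" for x
    proof -
      have "((\<lambda>s. w (x, s)) has_real_derivative 0) (at y)"
        by (rule has_field_derivative_transform_within_open[of "\<lambda>_. 0" _ _ "{0<..<1}"])
          (use y w0 in auto)
      then show ?thesis using dw_y[OF y] DERIV_unique by blast
    qed
    then have "u\<^sub>x (x, y) = 0" for x using incompressible[OF y, of x] by simp
    then show ?thesis
      using DERIV_isconst_all[of "\<lambda>s. u (s, y)" x 0] du_x[OF y] by simp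
  qed
  \<comment> \<open>No derivative is available on the walls themselves; there the identity holds by continuity.\<close>
  have u_all: "u z = u (0, snd z)" if "z \<in> closure strip" for z
  proof -
    have "continuous_on (UNIV \<times> {0..1}) (\<lambda>z :: real \<times> real. u (0, snd z))"
      by (rule continuous_on_compose2[OF cont(1)]) (auto intro!: continuous_intros)
    then have "continuous_on (closure strip) (\<lambda>z. u z - u (0, snd z))"
      unfolding closure_strip by (rule continuous_on_diff[OF cont(1)])
    moreover have "u z - u (0, snd z) = 0" if "z \<in> strip" for z
      using that u_inner[of "snd z" "fst z"] by (auto simp: strip_def)
    ultimately have "u z - u (0, snd z) = 0"
      using continuous_constant_on_closure[of strip "\<lambda>z. u z - u (0, snd z)" 0 z] that by blast
    then show ?thesis by simp
  qed
  show ?thesis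
  proof (intro exI ballI)
    fix z assume z: "z \<in> closure strip"
    then have "w z = 0" using w0[of "snd z" "fst z"] by (auto simp: closure_strip)
    then show "v z = ((\<lambda>y. u (0, y)) (snd z), 0)"
      using u_all[OF z] by (simp add: u_def w_def prod_eq_iff)
  qed
qed

end
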